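(* If $\beta\le 1/(2n)$, then (for any incentive graph $G$ and synergy graph $\widetilde G$) full revelation is optimal.
   Context: Model. There are one principal and $n$ agents. Agent $i$ chooses $a_i\in\mathbb R$; $\mathbf a=(a_1,\dots,a_n)'$. The state $\mathbf x=(x_1,\dots,x_n)'$ is distributed as $N(\mu\mathbf 1_n,\sigma^2 I_n)$, with $\mu\in\mathbb R$, $\sigma^2>0$, $\mathbf 1_n$ the vector of ones. The incentive graph $G=[g_{ij}]$ and the synergy graph $\widetilde G=[\tilde g_{ij}]$ are symmetric $n\times n$ matrices with entries in $\{0,1\}$ and zero diagonal; $\beta\ge0$ is a parameter. Agent $i$'s payoff is $u_i(\mathbf a,\mathbf x)=-(a_i-x_i)^2-\beta\sum_{j} g_{ij}(a_i-a_j)^2$; the principal's payoff is $v(\mathbf a,\mathbf x)=-\sum_i (a_i-x_i)^2-\beta\sum_i\sum_j\tilde g_{ij}(a_i-a_j)^2$. A public signal is a map (Markov kernel) $\varphi:\mathbb R^n\to\Delta(M)$, $M$ a measurable space. All agents observe the realization $m$ and nothing else, form $\hat{\mathbf x}=\mathbb E[\mathbf x\mid m]$, and play the unique Nash equilibrium $\mathbf a^*=B\hat{\mathbf x}$, $B=(I_n+\beta L)^{-1}$, where $L=D_G-G$ and $\widetilde L=D_{\widetilde G}-\widetilde G$ are the graph Laplacians ($D$ the diagonal degree matrix). Then $\mathbb E[v(\mathbf a^*,\mathbf x)]=-\mathbb E[\mathbf x'\mathbf x]+\mathbb E[\hat{\mathbf x}'V\hat{\mathbf x}]$ with $V=B'(I_n-2\beta(\widetilde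 L-L))B$. A signal is optimal if it maximizes $\mathbb E[v(\mathbf a^*,\mathbf x)]$ (equivalently $\mathbb E[\hat{\mathbf x}'V\hat{\mathbf x}]$) over all public signals. Full revelation is the signal $m=\mathbf x$. *)

theory Defs
  imports "HOL-Probability.Probability"
begin

definition graph_matrix :: "real^'n^'n \<Rightarrow> bool" where
  "graph_matrix G \<longleftrightarrow> (\<forall>i j. G $ i $ j \<in> {0, 1}) \<and> transpose G = G \<and> (\<forall>i. G $ i $ i = 0)"

definition degree_matrix :: "real^'n^'n \<Rightarrow> real^'n^'n" where
  "degree_matrix G = (\<chi> i j. if i = j then (\<Sum>k\<in>UNIV. G $ i $ k) else 0)"

definition graph_laplacian :: "real^'n^'n \<Rightarrow> real^'n^'n" where
  "graph_laplacian G = degree_matrix G - G"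

definition agent_payoff :: "real \<Rightarrow> real^'n^'n \<Rightarrow> 'n \<Rightarrow> real^'n \<Rightarrow> real^'n \<Rightarrow> real" where
  "agent_payoff \<beta> G i a x =
     - (a $ i - x $ i)\<^sup>2 - \<beta> * (\<Sum>j\<in>UNIV. G $ i $ j * (a $ i - a $ j)\<^sup>2)"

definition principal_payoff :: "real \<Rightarrow> real^'n^'n \<Rightarrow> real^'n \<Rightarrow> real^'n \<Rightarrow> real" where
  "principal_payoff \<beta> Gt a x =
     - (\<Sum>i\<in>UNIV. (a $ i - x $ i)\<^sup>2)
     - \<beta> * (\<Sum>i\<in>UNIV. \<Sum>j\<in>UNIV. Gt $ i $ j * (a $ i - a $ j)\<^sup>2)"

definition equilibrium_matrix :: "real \<Rightarrow> real^'n^'n \<Rightarrow> real^'n^'n" where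
  "equilibrium_matrix \<beta> G = matrix_inv (mat 1 + \<beta> *\<^sub>R graph_laplacian G)"

text \<open>Since the coordinates are independent with variance \<open>\<sigma>\<^sup>2\<close>, the law
  \<open>N(\<mu>1, \<sigma>\<^sup>2I)\<close> is the image of a product of one-dimensional normal laws; the parameter \<open>\<sigma>\<close> of
  \<^const>\<open>normal_density\<close> is the standard deviation.\<close>

definition state_prior :: "real \<Rightarrow> real \<Rightarrow> (real^'n) measure" where
  "state_prior \<mu> \<sigma> =
     distr (\<Pi>\<^sub>M i\<in>(UNIV :: 'n set). density lborel (\<lambda>t. ennreal (normal_density \<mu> \<sigma> t)))
       borel (\<lambda>f. \<chi> i. f i)"

definition public_signal :: "'m measure \<Rightarrow> (real^'n \<Rightarrow> 'm measure) \<Rightarrow> bool" where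
  "public_signal M \<phi> \<longleftrightarrow> \<phi> \<in> borel \<rightarrow>\<^sub>M prob_algebra M"

text \<open>Joint law of the state and the realized message.\<close>

definition joint_law ::
  "real \<Rightarrow> real \<Rightarrow> 'm measure \<Rightarrow> (real^'n \<Rightarrow> 'm measure) \<Rightarrow> ((real^'n) \<times> 'm) measure" where
  "joint_law \<mu> \<sigma> M \<phi> =
     state_prior \<mu> \<sigma> \<bind> (\<lambda>x. \<phi> x \<bind> (\<lambda>m. return (borel \<Otimes>\<^sub>M M) (x, m)))"

text \<open>The conditional expectation of the state given the message: a random vector on the joint
  space, measurable with respect to the sigma-algebra generated by the message coordinate.\<close>

definition posterior_mean ::
  "real \<Rightarrow> real \<Rightarrow> 'm measure \<Rightarrow> (real^'n \<Rightarrow> 'm measure) \<Rightarrow> (real^'n) \<times> 'm \<Rightarrow> real^'n" where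
  "posterior_mean \<mu> \<sigma> M \<phi> \<omega> =
     (\<chi> i. real_cond_exp (joint_law \<mu> \<sigma> M \<phi>)
            (vimage_algebra (space (borel \<Otimes>\<^sub>M M)) snd M) (\<lambda>\<omega>'. fst \<omega>' $ i) \<omega>)"

definition principal_value ::
  "real \<Rightarrow> real^'n^'n \<Rightarrow> real^'n^'n \<Rightarrow> real \<Rightarrow> real \<Rightarrow>
   'm measure \<Rightarrow> (real^'n \<Rightarrow> 'm measure) \<Rightarrow> real" where
  "principal_value \<beta> G Gt \<mu> \<sigma> M \<phi> =
     (\<integral>\<omega>. principal_payoff \<beta> Gt (equilibrium_matrix \<beta> G *v posterior_mean \<mu> \<sigma> M \<phi> \<omega>) (fst \<omega>)
        \<partial>joint_law \<mu> \<sigma> M \<phi>)"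

text \<open>Optimality compares with signals whose messages have type \<open>'k\<close>; leaving \<open>'k\<close> a free type
  variable in a theorem quantifies over arbitrary message spaces.\<close>

definition optimal_signal ::
  "'k itself \<Rightarrow> real \<Rightarrow> real^'n^'n \<Rightarrow> real^'n^'n \<Rightarrow> real \<Rightarrow> real \<Rightarrow>
   'm measure \<Rightarrow> (real^'n \<Rightarrow> 'm measure) \<Rightarrow> bool" where
  "optimal_signal T \<beta> G Gt \<mu> \<sigma> M \<phi> \<longleftrightarrow>
     public_signal M \<phi> \<and>
     (\<forall>(M' :: 'k measure) \<phi>'. public_signal M' \<phi>' \<longrightarrow>
        principal_value \<beta> G Gt \<mu> \<sigma> M' \<phi>' \<le> principal_value \<beta> G Gt \<mu> \<sigma> M \<phi>)"

text \<open>The signal \<open>m = x\<close>, to be used with message space \<^term>\<open>borel\<close>.\<close>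

definition full_revelation :: "real^'n \<Rightarrow> (real^'n) measure" where
  "full_revelation x = return borel x"

text \<open>The remainder justifies the linear formula for play used in \<open>principal_value\<close>: when the
  agents share a belief \<open>\<nu>\<close> about the state, the unique Nash equilibrium applies
  \<open>equilibrium_matrix\<close> to the mean of \<open>\<nu>\<close>.\<close>

definition nash_equilibrium :: "real \<Rightarrow> real^'n^'n \<Rightarrow> (real^'n) measure \<Rightarrow> real^'n \<Rightarrow> bool" where
  "nash_equilibrium \<beta> G \<nu> a \<longleftrightarrow>
     (\<forall>i t. (\<integral>x. agent_payoff \<beta> G i (\<chi> j. if j = i then t else a $ j) x \<partial>\<nu>)
          \<le> (\<integral>x. agent_payoff \<beta> G i a x \<partial>\<nu>))"

lemma laplacian_mult_vec:
  fixes G :: "real^'n^'n"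
  shows "(graph_laplacian G *v a) $ i = (\<Sum>j\<in>UNIV. G $ i $ j * (a $ i - a $ j))"
proof -
  have "(graph_laplacian G *v a) $ i
      = (\<Sum>j\<in>UNIV. (if i = j then (\<Sum>k\<in>UNIV. G $ i $ k) * a $ j else 0) - G $ i $ j * a $ j)"
    unfolding graph_laplacian_def degree_matrix_def matrix_vector_mult_def
    by (simp add: left_diff_distrib if_distrib[where f = "\<lambda>u. u * _"] cong: if_cong)
  also have "\<dots> = (\<Sum>k\<in>UNIV. G $ i $ k) * a $ i - (\<Sum>j\<in>UNIV. G $ i $ j * a $ j)"
    by (simp add: sum_subtractf)
  also have "\<dots> = (\<Sum>j\<in>UNIV. G $ i $ j * (a $ i - a $ j))"
    by (simp add: sum_distrib_right sum_subtractf right_diff_distrib)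
  finally show ?thesis .
qed

lemma laplacian_quadratic_form:
  fixes G :: "real^'n^'n"
  assumes "transpose G = G"
  shows "2 * (a \<bullet> (graph_laplacian G *v a))
    = (\<Sum>i\<in>UNIV. \<Sum>j\<in>UNIV. G $ i $ j * (a $ i - a $ j)\<^sup>2)"
proof -
  have sym: "G $ i $ j = G $ j $ i" for i j
    using assms by (metis transpose_def vec_lambda_beta)
  have 1: "a \<bullet> (graph_laplacian G *v a)
      = (\<Sum>i\<in>UNIV. \<Sum>j\<in>UNIV. G $ i $ j * (a $ i - a $ j) * a $ i)"
    by (simp add: inner_vec_def laplacian_mult_vec sum_distrib_left mult_ac)
  also have "\<dots> = (\<Sum>j\<in>UNIV. \<Sum>i\<in>UNIV. G $ i $ j * (a $ i - a $ j) * a $ i)"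
    by (rule sum.swap)
  also have "\<dots> = (\<Sum>i\<in>UNIV. \<Sum>j\<in>UNIV. G $ i $ j * (a $ j - a $ i) * a $ j)"
    by (subst sym) simp
  finally have 2: "a \<bullet> (graph_laplacian G *v a)
      = (\<Sum>i\<in>UNIV. \<Sum>j\<in>UNIV. G $ i $ j * (a $ j - a $ i) * a $ j)" .
  have "2 * (a \<bullet> (graph_laplacian G *v a))
     = (\<Sum>i\<in>UNIV. \<Sum>j\<in>UNIV. G $ i $ j * (a $ i - a $ j) * a $ i + G $ i $ j * (a $ j - a $ i) * a $ j)"
    using 1 2 by (simp add: sum.distrib)
  also have "\<dots> = (\<Sum>i\<in>UNIV. \<Sum>j\<in>UNIV. G $ i $ j * (a $ i - a $ j)\<^sup>2)"
    by (intro sum.cong refl) (simp add: power2_eq_square algebra_simps)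
  finally show ?thesis .
qed

lemma equilibrium_matrix_inverse:
  fixes G :: "real^'n^'n"
  assumes "graph_matrix G" "\<beta> \<ge> 0"
  shows "equilibrium_matrix \<beta> G ** (mat 1 + \<beta> *\<^sub>R graph_laplacian G) = mat 1"
    and "(mat 1 + \<beta> *\<^sub>R graph_laplacian G) ** equilibrium_matrix \<beta> G = mat 1"
proof -
  let ?A = "mat 1 + \<beta> *\<^sub>R graph_laplacian G"
  have "y = 0" if "?A *v y = 0" for y
  proof -
    have nn: "0 \<le> (\<Sum>i\<in>UNIV. \<Sum>j\<in>UNIV. G $ i $ j * (y $ i - y $ j)\<^sup>2)"
      using assms(1) unfolding graph_matrix_def
      by (intro sum_nonneg mult_nonneg_nonneg) (metis empty_iff insert_iff order_refl zero_le_one, simp)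
    have "0 = y \<bullet> (?A *v y)" using that by simp
    also have "\<dots> = y \<bullet> y + \<beta> * (y \<bullet> (graph_laplacian G *v y))"
      by (simp add: matrix_vector_mult_add_rdistrib inner_add_right scaleR_matrix_vector_assoc[symmetric])
    finally have "y \<bullet> y \<le> 0"
      using nn assms laplacian_quadratic_form[of G y]
      by (smt (verit) graph_matrix_def mult_nonneg_nonneg)
    then show ?thesis using inner_ge_zero[of y] by (simp add: order_antisym_conv)
  qed
  then have "invertible ?A"
    by (metis invertible_left_inverse matrix_left_invertible_ker)
  then show "equilibrium_matrix \<beta> G ** ?A = mat 1" "?A ** equilibrium_matrix \<beta> G = mat 1"
    unfolding equilibrium_matrix_def matrix_inv_def invertible_def
    by (metis (mono_tags, lifting) someI_ex)+
qed

lemma quadratic_argmax: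
  fixes p :: real
  assumes "p > 0"
  shows "(\<forall>t. - p * t\<^sup>2 + q * t \<le> - p * s\<^sup>2 + q * s) \<longleftrightarrow> 2 * p * s = q"
proof
  assume opt: "\<forall>t. - p * t\<^sup>2 + q * t \<le> - p * s\<^sup>2 + q * s"
  define d where "d = q / (2 * p) - s"
  have q: "q = 2 * p * (s + d)" using assms by (simp add: d_def)
  have "- p * (s + d)\<^sup>2 + q * (s + d) \<le> - p * s\<^sup>2 + q * s" using opt by blast
  then have "p * d\<^sup>2 \<le> 0" unfolding q by (simp add: power2_eq_square algebra_simps)
  then have "d = 0" using assms by (simp add: mult_le_0_iff)
  then show "2 * p * s = q" using q by simp
next
  assume "2 * p * s = q"
  then have "- p * s\<^sup>2 + q * s - (- p * t\<^sup>2 + q * t) = p * (s - t)\<^sup>2" for t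
    by (auto simp: power2_eq_square algebra_simps)
  then show "\<forall>t. - p * t\<^sup>2 + q * t \<le> - p * s\<^sup>2 + q * s"
    using assms by (smt (verit) mult_nonneg_nonneg zero_le_power2)
qed

theorem nash_equilibrium_iff:
  fixes G :: "real^'n^'n" and \<nu> :: "(real^'n) measure"
  assumes G: "graph_matrix G" and \<beta>: "\<beta> \<ge> 0"
    and \<nu>: "prob_space \<nu>" "sets \<nu> = sets borel"
    and sq: "\<And>i. integrable \<nu> (\<lambda>x. (x $ i)\<^sup>2)"
  shows "nash_equilibrium \<beta> G \<nu> a \<longleftrightarrow>
    a = equilibrium_matrix \<beta> G *v (\<chi> i. \<integral>x. x $ i \<partial>\<nu>)"
proof -
  interpret prob_space \<nu> by fact
  have [measurable_cong]: "sets \<nu> = sets borel" by fact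
  have int: "integrable \<nu> (\<lambda>x. x $ i)" for i
    by (rule square_integrable_imp_integrable[OF _ sq]) measurable
  define e where "e i = (\<integral>x. x $ i \<partial>\<nu>)" for i
  define w where "w i = (\<integral>x. (x $ i)\<^sup>2 \<partial>\<nu>)" for i
  let ?A = "mat 1 + \<beta> *\<^sub>R graph_laplacian G"
  have g0: "0 \<le> G $ i $ j" for i j
    using G unfolding graph_matrix_def by (metis empty_iff insert_iff order_refl zero_le_one)
  have diag: "G $ i $ i = 0" for i using G by (simp add: graph_matrix_def)
  have pay: "(\<integral>x. agent_payoff \<beta> G i b x \<partial>\<nu>)
      = - (b $ i)\<^sup>2 + 2 * b $ i * e i - w i - \<beta> * (\<Sum>j\<in>UNIV. G $ i $ j * (b $ i - b $ j)\<^sup>2)" for i b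
  proof -
    let ?c = "\<beta> * (\<Sum>j\<in>UNIV. G $ i $ j * (b $ i - b $ j)\<^sup>2)"
    have "(\<integral>x. agent_payoff \<beta> G i b x \<partial>\<nu>) =
        (\<integral>x. (- (b $ i)\<^sup>2 - ?c) + 2 * b $ i * x $ i - (x $ i)\<^sup>2 \<partial>\<nu>)"
      unfolding agent_payoff_def
      by (intro Bochner_Integration.integral_cong refl) (simp add: power2_eq_square algebra_simps)
    also have "\<dots> = (- (b $ i)\<^sup>2 - ?c) + 2 * b $ i * e i - w i"
      unfolding e_def w_def using int[of i] sq[of i] prob_space
      by (simp del: integral_mult_right_zero add: Bochner_Integration.integral_mult_right)
    finally show ?thesis by simp
  qed
  define p where "p i = 1 + \<beta> * (\<Sum>j\<in>UNIV. G $ i $ j)" for i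
  define q where "q i = 2 * e i + 2 * \<beta> * (\<Sum>j\<in>UNIV. G $ i $ j * a $ j)" for i
  define r where "r i = w i + \<beta> * (\<Sum>j\<in>UNIV. G $ i $ j * (a $ j)\<^sup>2)" for i
  have p: "p i > 0" for i
  proof -
    have "0 \<le> \<beta> * (\<Sum>j\<in>UNIV. G $ i $ j)" using \<beta> g0 by (intro mult_nonneg_nonneg sum_nonneg) auto
    then show ?thesis by (simp add: p_def)
  qed
  have expand: "(\<Sum>j\<in>UNIV. G $ i $ j * (t - a $ j)\<^sup>2) = (\<Sum>j\<in>UNIV. G $ i $ j) * t\<^sup>2
      - 2 * t * (\<Sum>j\<in>UNIV. G $ i $ j * a $ j) + (\<Sum>j\<in>UNIV. G $ i $ j * (a $ j)\<^sup>2)" for i t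
    by (simp add: power2_diff sum_distrib_left sum_distrib_right sum_subtractf[symmetric]
        sum.distrib[symmetric] algebra_simps)
  have form: "(\<integral>x. agent_payoff \<beta> G i (\<chi> j. if j = i then t else a $ j) x \<partial>\<nu>)
      = - p i * t\<^sup>2 + q i * t - r i" for i t
  proof -
    have "(\<Sum>j\<in>UNIV. G $ i $ j * (t - (if j = i then t else a $ j))\<^sup>2)
        = (\<Sum>j\<in>UNIV. G $ i $ j * (t - a $ j)\<^sup>2)"
      by (intro sum.cong) (auto simp: diag)
    then show ?thesis
      unfolding pay vec_lambda_beta if_P[OF refl]
      by (simp only: expand) (simp add: p_def q_def r_def algebra_simps)
  qed
  have upd: "(\<chi> j. if j = i then a $ i else a $ j) = a" for i by (simp add: vec_eq_iff)
  have "nash_equilibrium \<beta> G \<nu> a \<longleftrightarrow>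
      (\<forall>i t. - p i * t\<^sup>2 + q i * t \<le> - p i * (a $ i)\<^sup>2 + q i * a $ i)"
    unfolding nash_equilibrium_def form
    using form[of i "a $ i" for i, unfolded upd] by simp
  also have "\<dots> \<longleftrightarrow> (\<forall>i. 2 * p i * a $ i = q i)"
    using quadratic_argmax[OF p] by simp
  also have "\<dots> \<longleftrightarrow> (\<forall>i. (?A *v a) $ i = e i)"
  proof -
    have "(?A *v a) $ i = p i * a $ i - \<beta> * (\<Sum>j\<in>UNIV. G $ i $ j * a $ j)" for i
    proof -
      have "(?A *v a) $ i = a $ i + \<beta> * (graph_laplacian G *v a) $ i"
        by (simp add: matrix_vector_mult_add_rdistrib scaleR_matrix_vector_assoc[symmetric])
      then show ?thesis
        by (simp add: laplacian_mult_vec p_def right_diff_distrib distrib_right sum_subtractf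
            sum_distrib_right mult.assoc)
    qed
    then have "2 * p i * a $ i = q i \<longleftrightarrow> (?A *v a) $ i = e i" for i
      using mult.assoc[of 2 "p i" "a $ i"] by (simp add: q_def mult.assoc) linarith
    then show ?thesis by simp
  qed
  also have "\<dots> \<longleftrightarrow> ?A *v a = (\<chi> i. e i)" by (simp add: vec_eq_iff)
  also have "\<dots> \<longleftrightarrow> a = equilibrium_matrix \<beta> G *v (\<chi> i. e i)"
    using equilibrium_matrix_inverse[OF G \<beta>]
    by (metis matrix_vector_mul_assoc matrix_vector_mul_lid)
  finally show ?thesis by (simp add: e_def)
qed

end

theory Submission
  imports Defs
begin

text \<open>After eliminating the state by \<open>E[a \<bullet> x] = E[a \<bullet> x\<^sub>h]\<close>, the principal's value is a constant plus
  the expectation of the quadratic form \<open>a \<bullet> (I + 2\<beta>L - 2\<beta>L\<^sub>t) a\<close>, where \<open>a = B x\<^sub>h\<close> and \<open>x\<^sub>h\<close> is the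
  posterior mean. Laplacian eigenvalues of a graph on \<open>n\<close> vertices lie between \<open>0\<close> and \<open>n\<close>, so for
  \<open>2\<beta>n \<le> 1\<close> this form is positive semidefinite, hence convex. The tangent inequality at \<open>x\<^sub>h\<close> has a
  linear term \<open>(x - x\<^sub>h) \<bullet> K x\<^sub>h\<close>, which has mean zero because the residual of a conditional
  expectation is orthogonal to it; integrating the inequality compares any signal with the choice
  \<open>x\<^sub>h = x\<close>.\<close>

section \<open>The Gaussian prior: marginals and second moments\<close>

lemma measurable_vec_lambda:
  fixes M :: "'n::finite \<Rightarrow> real measure"
  assumes "\<And>i. sets (M i) = sets borel"
  shows "(\<lambda>f. \<chi> i. f i) \<in> (\<Pi>\<^sub>M i\<in>UNIV. M i) \<rightarrow>\<^sub>M (borel :: (real^'n) measure)"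
proof -
  have "(\<lambda>f. f i) \<in> borel_measurable (\<Pi>\<^sub>M i\<in>UNIV. M i)" for i
    using measurable_component_singleton[of i UNIV M] measurable_cong_sets[OF refl assms[of i]]
    by blast
  then show ?thesis
    by (subst borel_measurable_euclidean_space) (auto simp: Basis_vec_def inner_axis)
qed

lemma borel_measurable_vec_nth [measurable]: "(\<lambda>x::real^'n. x $ i) \<in> borel_measurable borel"
  by simp

lemma prob_space_state_prior:
  assumes "\<sigma> > 0"
  shows "prob_space (state_prior \<mu> \<sigma> :: (real^'n) measure)"
proof -
  interpret product_prob_space "\<lambda>_. density lborel (\<lambda>t. ennreal (normal_density \<mu> \<sigma> t))"
      "UNIV :: 'n set"
    using prob_space_normal_density[OF assms]
    by (simp add: product_prob_space_def product_prob_space_axioms_def product_sigma_finite_def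
        prob_space_imp_sigma_finite)
  show ?thesis
    unfolding state_prior_def by (rule prob_space_distr) (rule measurable_vec_lambda, simp)
qed

lemma sets_state_prior [simp, measurable_cong]: "sets (state_prior \<mu> \<sigma>) = sets borel"
  by (simp add: state_prior_def)

lemma space_state_prior [simp]: "space (state_prior \<mu> \<sigma>) = UNIV"
  by (simp add: state_prior_def)

lemma distr_state_prior_component:
  assumes "\<sigma> > 0"
  shows "distr (state_prior \<mu> \<sigma> :: (real^'n) measure) borel (\<lambda>x. x $ i)
    = density lborel (\<lambda>t. ennreal (normal_density \<mu> \<sigma> t))" (is "_ = ?N")
proof -
  have "distr (state_prior \<mu> \<sigma> :: (real^'n) measure) borel (\<lambda>x. x $ i)
      = distr (\<Pi>\<^sub>M i\<in>(UNIV :: 'n set). ?N) borel ((\<lambda>x. x $ i) \<circ> (\<lambda>f. \<chi> i. f i))"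
    unfolding state_prior_def by (rule distr_distr) (simp, rule measurable_vec_lambda, simp)
  \<comment> \<open>The target \<open>borel\<close> is replaced by \<open>?N\<close>, which has the
    same sets, because the projection rule for products pushes forward into the factor
    itself.\<close>
  also have "\<dots> = distr (\<Pi>\<^sub>M i\<in>(UNIV :: 'n set). ?N) ?N (\<lambda>f. f i)"
    by (rule distr_cong) auto
  also have "\<dots> = ?N"
    by (rule distr_PiM_component) (simp_all add: prob_space_normal_density[OF assms])
  finally show ?thesis .
qed

lemma integrable_state_prior_sq:
  assumes "\<sigma> > 0"
  shows "integrable (state_prior \<mu> \<sigma> :: (real^'n) measure) (\<lambda>x. (x $ i)\<^sup>2)"
proof -
  \<comment> \<open>The identity t^2 = (t - \<mu>)^2 + 2 \<mu> t - \<mu>^2 reduces the raw second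
    moment to the central moment, the mean and the total mass.\<close>
  have "integrable lborel (\<lambda>t. normal_density \<mu> \<sigma> t * (t - \<mu>)\<^sup>2
      + 2 * \<mu> * (normal_density \<mu> \<sigma> t * t) - \<mu>\<^sup>2 * normal_density \<mu> \<sigma> t)"
    using integrable_normal_moment[OF assms, of \<mu> 2] integrable_normal_moment_nz_1[OF assms, of \<mu>]
      integrable_normal_density[OF assms, of \<mu>]
    by auto
  then have "integrable lborel (\<lambda>t. normal_density \<mu> \<sigma> t * t\<^sup>2)"
    by (rule Bochner_Integration.integrable_cong[THEN iffD1, OF refl, rotated])
      (simp add: power2_eq_square algebra_simps)
  then have "integrable (density lborel (\<lambda>t. ennreal (normal_density \<mu> \<sigma> t))) (\<lambda>t. t\<^sup>2)"
    by (subst integrable_real_density) auto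
  then show ?thesis
    unfolding distr_state_prior_component[OF assms, of \<mu> i, symmetric]
    by (subst (asm) integrable_distr_eq) auto
qed

section \<open>Joint law of state and message\<close>

lemma joint_kernel_measurable:
  assumes "public_signal M \<phi>"
  shows "(\<lambda>x. \<phi> x \<bind> (\<lambda>m. return (borel \<Otimes>\<^sub>M M) (x, m))) \<in> borel \<rightarrow>\<^sub>M prob_algebra (borel \<Otimes>\<^sub>M M)"
  using assms unfolding public_signal_def by measurable

lemma state_prior_in_prob_algebra:
  assumes "\<sigma> > 0"
  shows "state_prior \<mu> \<sigma> \<in> space (prob_algebra borel)"
  using prob_space_state_prior[OF assms] by (simp add: space_prob_algebra)

lemma
  assumes "public_signal M \<phi>" "\<sigma> > 0"
  shows prob_space_joint_law: "prob_space (joint_law \<mu> \<sigma> M \<phi>)"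
    and sets_joint_law: "sets (joint_law \<mu> \<sigma> M \<phi>) = sets (borel \<Otimes>\<^sub>M M)"
  unfolding joint_law_def
  using prob_space_bind'[OF state_prior_in_prob_algebra[OF assms(2)] joint_kernel_measurable[OF assms(1)]]
    sets_bind'[OF state_prior_in_prob_algebra[OF assms(2)] joint_kernel_measurable[OF assms(1)]]
  by auto

text \<open>Given \<open>x\<close>, the first coordinate is surely \<open>x\<close>, so each kernel
  has a Dirac first marginal, and binding the prior with \<open>return\<close> gives the prior back.
  Expectations of functions of the state alone therefore do not depend on the signal.\<close>

lemma distr_joint_law_fst:
  assumes "public_signal M \<phi>" "\<sigma> > 0"
  shows "distr (joint_law \<mu> \<sigma> M \<phi>) borel fst = state_prior \<mu> \<sigma>"
proof -
  have \<phi>: "\<phi> \<in> borel \<rightarrow>\<^sub>M prob_algebra M"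
    using assms(1) by (simp add: public_signal_def)
  have kernel: "distr (\<phi> x \<bind> (\<lambda>m. return (borel \<Otimes>\<^sub>M M) (x, m))) borel fst = return borel x" for x
  proof -
    have px: "prob_space (\<phi> x)" "sets (\<phi> x) = sets M"
      using measurable_space[OF \<phi>, of x] by (auto simp: space_prob_algebra)
    interpret prob_space "\<phi> x" by fact
    have [measurable_cong]: "sets (\<phi> x) = sets M" by fact
    have "\<phi> x \<bind> (\<lambda>m. return (borel \<Otimes>\<^sub>M M) (x, m)) = distr (\<phi> x) (borel \<Otimes>\<^sub>M M) (\<lambda>m. (x, m))"
      by (rule bind_return_distr') (auto simp: not_empty)
    then have "distr (\<phi> x \<bind> (\<lambda>m. return (borel \<Otimes>\<^sub>M M) (x, m))) borel fst
        = distr (\<phi> x) borel (\<lambda>_. x)"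
      by (simp add: distr_distr comp_def)
    also have "\<dots> = return borel x" by simp
    finally show ?thesis .
  qed
  have "distr (joint_law \<mu> \<sigma> M \<phi>) borel fst = state_prior \<mu> \<sigma> \<bind> return borel"
    unfolding joint_law_def
    by (subst distr_bind[where K = "borel \<Otimes>\<^sub>M M"])
      (use joint_kernel_measurable[OF assms(1)] in \<open>auto simp: kernel intro!: measurable_prob_algebraD\<close>)
  also have "\<dots> = state_prior \<mu> \<sigma>" by (rule bind_return'') simp
  finally show ?thesis .
qed

lemma public_signal_full_revelation: "public_signal borel full_revelation"
  unfolding public_signal_def full_revelation_def by measurable

text \<open>The message copies the state, so all mass sits on the diagonal; this later makes the two
  coordinates equal almost everywhere.\<close>

lemma joint_law_full_revelation:
  "joint_law \<mu> \<sigma> borel full_revelation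
    = distr (state_prior \<mu> \<sigma>) (borel \<Otimes>\<^sub>M borel) (\<lambda>x::real^'n. (x, x))"
proof -
  have "full_revelation x \<bind> (\<lambda>m. return (borel \<Otimes>\<^sub>M borel) (x, m)) = return (borel \<Otimes>\<^sub>M borel) (x, x)"
    for x :: "real^'n"
    unfolding full_revelation_def by (rule bind_return[where N = "borel \<Otimes>\<^sub>M borel"]) auto
  then show ?thesis
    unfolding joint_law_def by (simp add: bind_return_distr')
qed

section \<open>L2 functions and conditional expectation\<close>

definition square_integrable :: "'a measure \<Rightarrow> ('a \<Rightarrow> real) \<Rightarrow> bool" where
  "square_integrable M f \<longleftrightarrow> f \<in> borel_measurable M \<and> integrable M (\<lambda>x. (f x)\<^sup>2)"

lemma square_integrable_mult:
  assumes "square_integrable M f" "square_integrable M g"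
  shows "integrable M (\<lambda>x. f x * g x)"
proof (rule Bochner_Integration.integrable_bound)
  show "integrable M (\<lambda>x. (f x)\<^sup>2 + (g x)\<^sup>2)" "(\<lambda>x. f x * g x) \<in> borel_measurable M"
    using assms by (auto simp: square_integrable_def)
  have "\<bar>f x * g x\<bar> \<le> (f x)\<^sup>2 + (g x)\<^sup>2" for x
    using sum_squares_bound[of "\<bar>f x\<bar>" "\<bar>g x\<bar>"] abs_ge_zero[of "f x * g x"]
    unfolding abs_mult power2_abs by linarith
  then show "AE x in M. norm (f x * g x) \<le> norm ((f x)\<^sup>2 + (g x)\<^sup>2)"
    by simp
qed

lemma square_integrable_add:
  assumes "square_integrable M f" "square_integrable M g"
  shows "square_integrable M (\<lambda>x. f x + g x)"
  using assms square_integrable_mult[OF assms]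
  by (auto simp: square_integrable_def power2_sum mult.assoc)

lemma square_integrable_cmult:
  "square_integrable M f \<Longrightarrow> square_integrable M (\<lambda>x. c * f x)"
  by (auto simp: square_integrable_def power_mult_distrib)

lemma square_integrable_diff:
  assumes "square_integrable M f" "square_integrable M g"
  shows "square_integrable M (\<lambda>x. f x - g x)"
  using square_integrable_add[OF assms(1) square_integrable_cmult[OF assms(2), of "-1"]] by simp

lemma square_integrable_sum:
  "(\<And>i. i \<in> I \<Longrightarrow> square_integrable M (f i)) \<Longrightarrow> square_integrable M (\<lambda>x. \<Sum>i\<in>I. f i x)"
  \<comment> \<open>Empty and infinite index sets both give the zero function, the latter because a
    sum over an infinite set is 0 by default.\<close>
  by (induction I rule: infinite_finite_induct)
    (auto intro!: square_integrable_add, auto simp: square_integrable_def)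

text \<open>The payoff is a combination of squares of differences, and each difference is linear in
  the coordinates of \<open>y\<close> and \<open>x\<close>, hence in L2.\<close>

lemma integrable_principal_payoff:
  fixes B :: "real^'n^'n"
  assumes "\<And>i. square_integrable M (\<lambda>\<omega>. y \<omega> $ i)" "\<And>i. square_integrable M (\<lambda>\<omega>. x \<omega> $ i)"
  shows "integrable M (\<lambda>\<omega>. principal_payoff \<beta> Gt (B *v y \<omega>) (x \<omega>))"
proof -
  have B: "square_integrable M (\<lambda>\<omega>. (B *v y \<omega>) $ i)" for i
    unfolding matrix_vector_mult_def vec_lambda_beta
    by (intro square_integrable_sum square_integrable_cmult assms)
  have "integrable M (\<lambda>\<omega>. ((B *v y \<omega>) $ i - x \<omega> $ i)\<^sup>2)"
    "integrable M (\<lambda>\<omega>. ((B *v y \<omega>) $ i - (B *v y \<omega>) $ j)\<^sup>2)" for i j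
    using square_integrable_diff[OF B assms(2)] square_integrable_diff[OF B B]
    by (auto simp: square_integrable_def)
  then show ?thesis
    unfolding principal_payoff_def
    by (intro Bochner_Integration.integrable_diff integrable_minus Bochner_Integration.integrable_sum integrable_mult_right)
qed

text \<open>Conditional Jensen for the convex function t^2.\<close>

lemma (in finite_measure_subalgebra) square_integrable_real_cond_exp:
  assumes "square_integrable M f"
  shows "square_integrable M (real_cond_exp M F f)"
proof -
  have "integrable M (\<lambda>x. (real_cond_exp M F f x)\<^sup>2)"
  proof (rule integrable_convex_cond_exp[where I = UNIV and q = "\<lambda>t. t\<^sup>2"])
    show "integrable M f"
      using assms square_integrable_imp_integrable by (auto simp: square_integrable_def)
  qed (use assms in \<open>auto simp: square_integrable_def convex_power2\<close>)
  then show ?thesis by (simp add: square_integrable_def)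
qed

text \<open>The conditional expectation of \<open>f\<close> is \<open>F\<close>-measurable, so
  multiplying by it does not distinguish \<open>g\<close> from its conditional expectation under the
  integral. Two functions are allowed because different coordinates of the state get paired.\<close>

lemma (in finite_measure_subalgebra) real_cond_exp_residual_orthogonal:
  assumes f: "square_integrable M f" and g: "square_integrable M g"
  shows "(\<integral>x. real_cond_exp M F f x * (g x - real_cond_exp M F g x) \<partial>M) = 0"
proof -
  note sf = square_integrable_real_cond_exp[OF f] and sg = square_integrable_real_cond_exp[OF g]
  have "(\<integral>x. real_cond_exp M F f x * real_cond_exp M F g x \<partial>M) = (\<integral>x. real_cond_exp M F f x * g x \<partial>M)"
    by (rule real_cond_exp_intg(2)[OF square_integrable_mult[OF sf g]])
      (use g in \<open>auto simp: square_integrable_def\<close>)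
  then show ?thesis
    using square_integrable_mult[OF sf g] square_integrable_mult[OF sf sg]
    by (simp add: right_diff_distrib)
qed

section \<open>Laplacian bounds and the tangent inequality\<close>

lemma sum_nth_diff_squares:
  fixes a :: "real^'n"
  shows "(\<Sum>i\<in>UNIV. \<Sum>j\<in>UNIV. (a $ i - a $ j)\<^sup>2)
    = 2 * real CARD('n) * (a \<bullet> a) - 2 * (\<Sum>i\<in>UNIV. a $ i)\<^sup>2"
  by (simp add: power2_diff sum.distrib sum_subtractf inner_vec_def power2_eq_square sum_product
      sum_distrib_left sum_distrib_right algebra_simps)

text \<open>Edge weights are at most 1, so the complete graph dominates; its quadratic form is n
  times \<open>a \<bullet> a\<close> minus the square of the coordinate sum.\<close>

lemma graph_laplacian_le_card:
  fixes G :: "real^'n^'n"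
  assumes "graph_matrix G"
  shows "a \<bullet> (graph_laplacian G *v a) \<le> real CARD('n) * (a \<bullet> a)"
proof -
  have "G $ i $ j * (a $ i - a $ j)\<^sup>2 \<le> (a $ i - a $ j)\<^sup>2" for i j
  proof -
    have "G $ i $ j \<in> {0, 1}" using assms by (simp add: graph_matrix_def)
    then show ?thesis by auto
  qed
  then have "2 * (a \<bullet> (graph_laplacian G *v a)) \<le> (\<Sum>i\<in>UNIV. \<Sum>j\<in>UNIV. (a $ i - a $ j)\<^sup>2)"
    using assms by (subst laplacian_quadratic_form) (auto simp: graph_matrix_def intro!: sum_mono)
  then show ?thesis
    using zero_le_power2[of "\<Sum>i\<in>UNIV. a $ i"] unfolding sum_nth_diff_squares by linarith
qed

lemma graph_laplacian_nonneg:
  fixes G :: "real^'n^'n"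
  assumes "graph_matrix G"
  shows "0 \<le> a \<bullet> (graph_laplacian G *v a)"
proof -
  have "0 \<le> G $ i $ j * (a $ i - a $ j)\<^sup>2" for i j
  proof -
    have "G $ i $ j \<in> {0, 1}" using assms by (simp add: graph_matrix_def)
    then show ?thesis by auto
  qed
  then have "0 \<le> 2 * (a \<bullet> (graph_laplacian G *v a))"
    using assms by (subst laplacian_quadratic_form) (auto simp: graph_matrix_def intro!: sum_nonneg)
  then show ?thesis by simp
qed

lemma graph_laplacian_symmetric:
  fixes G :: "real^'n^'n"
  assumes "graph_matrix G"
  shows "u \<bullet> (graph_laplacian G *v w) = (graph_laplacian G *v u) \<bullet> w"
proof -
  have "transpose (graph_laplacian G) = graph_laplacian G"
    using assms by (auto simp: graph_matrix_def graph_laplacian_def degree_matrix_def transpose_def vec_eq_iff)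
  then show ?thesis by (metis dot_lmul_matrix vector_transpose_matrix)
qed

text \<open>The penalty runs over ordered pairs and counts every edge twice, which is where the
  factor 2 in front of \<open>\<beta>\<close> comes from.\<close>

lemma principal_payoff_eq:
  fixes Gt :: "real^'n^'n"
  assumes "graph_matrix Gt"
  shows "principal_payoff \<beta> Gt a x
    = 2 * (a \<bullet> x) - x \<bullet> x - a \<bullet> a - 2 * \<beta> * (a \<bullet> (graph_laplacian Gt *v a))"
proof -
  have "(\<Sum>i\<in>UNIV. (a $ i - x $ i)\<^sup>2) = (a - x) \<bullet> (a - x)"
    by (simp add: inner_vec_def power2_eq_square)
  also have "\<dots> = a \<bullet> a - 2 * (a \<bullet> x) + x \<bullet> x"
    by (simp add: inner_diff_left inner_diff_right inner_commute)
  finally show ?thesis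
    unfolding principal_payoff_def
    using laplacian_quadratic_form[of Gt a] assms by (simp add: graph_matrix_def)
qed

text \<open>With \<open>N = I + 2\<beta>L\<^sub>t\<close>, \<open>A = I + \<beta>L = B\<inverse>\<close> and \<open>d = B(x - y)\<close>, the two sides differ by
  \<open>d \<bullet> (2A - N) d\<close>, and \<open>2A - N = I + 2\<beta>L - 2\<beta>L\<^sub>t\<close>.\<close>

lemma principal_payoff_gradient:
  fixes G Gt :: "real^'n^'n"
  assumes G: "graph_matrix G" and Gt: "graph_matrix Gt"
    and \<beta>: "\<beta> \<ge> 0" "\<beta> \<le> 1 / (2 * real CARD('n))"
  obtains K :: "real^'n^'n" where
    "\<And>x y. principal_payoff \<beta> Gt (equilibrium_matrix \<beta> G *v y) x + (x - y) \<bullet> (K *v y)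
      \<le> principal_payoff \<beta> Gt (equilibrium_matrix \<beta> G *v x) x"
proof
  let ?B = "equilibrium_matrix \<beta> G" and ?L = "graph_laplacian G" and ?Lt = "graph_laplacian Gt"
  let ?A = "mat 1 + \<beta> *\<^sub>R ?L" and ?N = "mat 1 + (2 * \<beta>) *\<^sub>R ?Lt"
  \<comment> \<open>\<open>?K *v y\<close> is the gradient at z = y of the payoff from action
    \<open>?B *v z\<close> in state \<open>y\<close>.\<close>
  let ?K = "2 *\<^sub>R (transpose ?B ** (mat 1 - ?N ** ?B))"
  fix x y :: "real^'n"
  define a d where "a = ?B *v y" and "d = ?B *v (x - y)"
  have A: "?A *v w = w + \<beta> *\<^sub>R (?L *v w)" and N: "?N *v w = w + (2 * \<beta>) *\<^sub>R (?Lt *v w)" for w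
    by (simp_all add: matrix_vector_mult_add_rdistrib scaleR_matrix_vector_assoc[symmetric])
  have xy: "y = ?A *v a" "x - y = ?A *v d"
    using equilibrium_matrix_inverse(2)[OF G \<beta>(1)]
    by (simp_all add: a_def d_def matrix_vector_mul_assoc)
  have b: "?B *v x = a + d"
    by (simp add: a_def d_def matrix_vector_mult_diff_distrib)
  have "(x - y) \<bullet> (?K *v y) = 2 * (d \<bullet> (y - ?N *v a))"
    by (simp add: a_def d_def scaleR_matrix_vector_assoc[symmetric] matrix_vector_mult_diff_rdistrib
        matrix_vector_mul_assoc[symmetric] dot_lmul_matrix[symmetric] vector_transpose_matrix
        del: transpose_matrix_vector)
  moreover have "principal_payoff \<beta> Gt (a + d) x - principal_payoff \<beta> Gt a x
      = 2 * (d \<bullet> x) - 2 * (d \<bullet> (?N *v a)) - d \<bullet> (?N *v d)"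
    using graph_laplacian_symmetric[OF Gt, of a d]
    unfolding principal_payoff_eq[OF Gt] N
    by (simp add: inner_add_left inner_add_right matrix_vector_right_distrib inner_commute algebra_simps)
  \<comment> \<open>The first-order gain is taken at the true state \<open>x\<close>, whereas
    \<open>?K\<close> evaluates it at \<open>y\<close>. The discrepancy x - y = A d turns into the
    curvature term that has to outweigh \<open>?N\<close>.\<close>
  moreover have "d \<bullet> x = d \<bullet> y + d \<bullet> (?A *v d)"
    using xy(2) by (metis inner_add_right add.commute diff_add_cancel)
  moreover have "d \<bullet> (?N *v d) \<le> 2 * (d \<bullet> (?A *v d))"
  proof -
    have "\<beta> * (d \<bullet> (?Lt *v d)) \<le> \<beta> * (real CARD('n) * (d \<bullet> d))"
      using graph_laplacian_le_card[OF Gt] \<beta>(1) by (rule mult_left_mono)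
    \<comment> \<open>Here the upper bound on \<open>\<beta>\<close> enters: the identity part of 2A
      - N absorbs the largest possible synergy term, and the incentive Laplacian only adds to the
      form.\<close>
    moreover have "2 * \<beta> * real CARD('n) * (d \<bullet> d) \<le> 1 * (d \<bullet> d)"
      using \<beta>(2) by (intro mult_right_mono) (auto simp: field_simps)
    moreover have "0 \<le> \<beta> * (d \<bullet> (?L *v d))"
      using graph_laplacian_nonneg[OF G] \<beta>(1) by simp
    ultimately show ?thesis
      unfolding A N by (simp add: inner_add_right)
  qed
  ultimately show "principal_payoff \<beta> Gt (?B *v y) x + (x - y) \<bullet> (?K *v y)
      \<le> principal_payoff \<beta> Gt (?B *v x) x"
    unfolding b a_def[symmetric] by (simp add: inner_diff_right)
qed

section \<open>Upper bound for an arbitrary signal\<close>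

lemma finite_measure_subalgebra_joint_law:
  assumes "public_signal M \<phi>" "\<sigma> > 0"
  shows "finite_measure_subalgebra (joint_law \<mu> \<sigma> M \<phi>)
    (vimage_algebra (space (borel \<Otimes>\<^sub>M M)) snd M)"
proof -
  have sp: "space (joint_law \<mu> \<sigma> M \<phi>) = space (borel \<Otimes>\<^sub>M M)"
    using sets_eq_imp_space_eq[OF sets_joint_law[OF assms]] .
  have "subalgebra (joint_law \<mu> \<sigma> M \<phi>) (vimage_algebra (space (borel \<Otimes>\<^sub>M M)) snd M)"
    unfolding subalgebra_def sets_joint_law[OF assms] sp
    by (simp add: sets_image_in_sets)
  then show ?thesis
    using prob_space.finite_measure[OF prob_space_joint_law[OF assms]]
    by (simp add: finite_measure_subalgebra_def finite_measure_subalgebra_axioms_def)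
qed

lemma measurable_fst_joint_law:
  assumes "public_signal M \<phi>" "\<sigma> > 0"
  shows "fst \<in> joint_law \<mu> \<sigma> M \<phi> \<rightarrow>\<^sub>M borel"
  by (simp add: measurable_cong_sets[OF sets_joint_law[OF assms] refl])

lemma square_integrable_joint_law_fst:
  assumes "public_signal M \<phi>" "\<sigma> > 0"
  shows "square_integrable (joint_law \<mu> \<sigma> M \<phi>) (\<lambda>\<omega>. fst \<omega> $ i)"
proof -
  note [measurable] = measurable_fst_joint_law[OF assms]
  have "integrable (distr (joint_law \<mu> \<sigma> M \<phi>) borel fst) (\<lambda>x. (x $ i)\<^sup>2)"
    unfolding distr_joint_law_fst[OF assms] by (rule integrable_state_prior_sq[OF assms(2)])
  then show ?thesis
    by (subst (asm) integrable_distr_eq) (auto simp: square_integrable_def)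
qed

lemma square_integrable_posterior_mean:
  assumes "public_signal M \<phi>" "\<sigma> > 0"
  shows "square_integrable (joint_law \<mu> \<sigma> M \<phi>) (\<lambda>\<omega>. posterior_mean \<mu> \<sigma> M \<phi> \<omega> $ i)"
  unfolding posterior_mean_def vec_lambda_beta
  by (rule finite_measure_subalgebra.square_integrable_real_cond_exp
      [OF finite_measure_subalgebra_joint_law[OF assms] square_integrable_joint_law_fst[OF assms]])

lemma principal_payoff_measurable [measurable]:
  fixes B :: "real^'n^'n"
  shows "(\<lambda>x. principal_payoff \<beta> Gt (B *v x) x) \<in> borel_measurable borel"
  unfolding principal_payoff_def matrix_vector_mult_def by simp measurable

text \<open>The bound is an integral under the prior, so it mentions neither the signal nor its
  message space and can serve for signals of different message types.\<close>

lemma principal_value_le: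
  fixes G Gt :: "real^'n^'n"
  assumes "graph_matrix G" "graph_matrix Gt" "\<sigma> > 0" "\<beta> \<ge> 0" "\<beta> \<le> 1 / (2 * real CARD('n))"
    and signal: "public_signal M \<phi>"
  shows "principal_value \<beta> G Gt \<mu> \<sigma> M \<phi>
    \<le> (\<integral>x. principal_payoff \<beta> Gt (equilibrium_matrix \<beta> G *v x) x \<partial>state_prior \<mu> \<sigma>)"
proof -
  let ?J = "joint_law \<mu> \<sigma> M \<phi>" and ?B = "equilibrium_matrix \<beta> G"
    and ?y = "posterior_mean \<mu> \<sigma> M \<phi>"
  interpret finite_measure_subalgebra ?J "vimage_algebra (space (borel \<Otimes>\<^sub>M M)) snd M"
    by (rule finite_measure_subalgebra_joint_law) fact+
  note [measurable] = measurable_fst_joint_law[OF signal assms(3)]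
  note x2 = square_integrable_joint_law_fst[OF signal assms(3)]
  note y2 = square_integrable_posterior_mean[OF signal assms(3)]
  obtain K :: "real^'n^'n" where K: "\<And>x y. principal_payoff \<beta> Gt (?B *v y) x + (x - y) \<bullet> (K *v y)
      \<le> principal_payoff \<beta> Gt (?B *v x) x"
    using principal_payoff_gradient assms by metis
  \<comment> \<open>The linear term is split into scalar products of one posterior coordinate with
    one residual coordinate, since conditional expectation is taken coordinatewise.\<close>
  have expand: "(x - y) \<bullet> (K *v y) = (\<Sum>i\<in>UNIV. \<Sum>j\<in>UNIV. K $ i $ j * (y $ j * (x $ i - y $ i)))"
    for x y :: "real^'n"
    by (simp add: inner_vec_def matrix_vector_mult_def sum_distrib_left mult_ac)
  have int: "integrable ?J (\<lambda>\<omega>. ?y \<omega> $ j * (fst \<omega> $ i - ?y \<omega> $ i))" for i j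
    by (intro square_integrable_mult square_integrable_diff x2 y2)
  have zero: "(\<integral>\<omega>. ?y \<omega> $ j * (fst \<omega> $ i - ?y \<omega> $ i) \<partial>?J) = 0" for i j
    unfolding posterior_mean_def vec_lambda_beta by (rule real_cond_exp_residual_orthogonal[OF x2 x2])
  have int': "integrable ?J (\<lambda>\<omega>. (fst \<omega> - ?y \<omega>) \<bullet> (K *v ?y \<omega>))"
    unfolding expand by (intro Bochner_Integration.integrable_sum integrable_mult_right int)
  have zero': "(\<integral>\<omega>. (fst \<omega> - ?y \<omega>) \<bullet> (K *v ?y \<omega>) \<partial>?J) = 0"
    unfolding expand by (simp add: Bochner_Integration.integral_sum int zero)
  \<comment> \<open>Adding the mean-zero linear term leaves the value unchanged and makes the
    tangent inequality applicable pointwise.\<close>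
  have "principal_value \<beta> G Gt \<mu> \<sigma> M \<phi> = (\<integral>\<omega>. principal_payoff \<beta> Gt (?B *v ?y \<omega>) (fst \<omega>)
      + (fst \<omega> - ?y \<omega>) \<bullet> (K *v ?y \<omega>) \<partial>?J)"
    unfolding principal_value_def
    by (subst Bochner_Integration.integral_add)
      (auto intro!: integrable_principal_payoff x2 y2 int' simp: zero')
  also have "\<dots> \<le> (\<integral>\<omega>. principal_payoff \<beta> Gt (?B *v fst \<omega>) (fst \<omega>) \<partial>?J)"
    by (intro integral_mono Bochner_Integration.integrable_add integrable_principal_payoff x2 y2 int' K)
  \<comment> \<open>The integrand now depends on the state alone, so the joint law may be replaced
    by its first marginal, the prior.\<close>
  also have "\<dots> = (\<integral>x. principal_payoff \<beta> Gt (?B *v x) x \<partial>distr ?J borel fst)"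
    by (rule integral_distr[symmetric]) auto
  finally show ?thesis
    unfolding distr_joint_law_fst[OF signal assms(3)] .
qed

section \<open>Full revelation attains the bound\<close>

lemma posterior_mean_full_revelation:
  fixes \<mu> \<sigma> :: real
  assumes "\<sigma> > 0"
  defines "J \<equiv> joint_law \<mu> \<sigma> borel (full_revelation :: real^'n \<Rightarrow> _)"
  shows "AE \<omega> in J. posterior_mean \<mu> \<sigma> borel full_revelation \<omega> = fst \<omega>"
proof -
  let ?F = "vimage_algebra (space (borel \<Otimes>\<^sub>M borel)) snd (borel :: (real^'n) measure)"
  note signal = public_signal_full_revelation
  interpret finite_measure_subalgebra J ?F
    unfolding J_def by (rule finite_measure_subalgebra_joint_law[OF signal assms(1)])
  have [measurable_cong]: "sets J = sets (borel \<Otimes>\<^sub>M borel)"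
    unfolding J_def by (rule sets_joint_law[OF signal assms(1)])
  have meas: "(\<lambda>\<omega>. fst \<omega> $ i) \<in> borel_measurable J" "(\<lambda>\<omega>. snd \<omega> $ i) \<in> borel_measurable J" for i
    by measurable
  have snd: "(\<lambda>\<omega>. snd \<omega> $ i) \<in> borel_measurable ?F" for i
    by (rule measurable_compose[OF measurable_vimage_algebra1]) auto
  have eq: "AE \<omega> in J. fst \<omega> $ i = snd \<omega> $ i" for i
    unfolding J_def joint_law_full_revelation
    by (subst AE_distr_iff) (auto intro!: borel_measurable_eq)
  have int: "integrable J (\<lambda>\<omega>. snd \<omega> $ i)" for i
  proof -
    have "integrable J (\<lambda>\<omega>. fst \<omega> $ i)"
      using square_integrable_joint_law_fst[OF signal assms(1), of \<mu> i]
      unfolding J_def[symmetric] square_integrable_def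
      by (elim conjE) (rule square_integrable_imp_integrable)
    then show ?thesis
      by (rule integrable_cong_AE_imp) (rule meas eq)+
  qed
  \<comment> \<open>The conditioning sigma-algebra is generated by \<open>snd\<close>. So
    \<open>fst\<close> is first exchanged for the a.e. equal \<open>snd\<close>, which is its own
    conditional expectation, and then exchanged back.\<close>
  have "AE \<omega> in J. real_cond_exp J ?F (\<lambda>\<omega>. fst \<omega> $ i) \<omega> = fst \<omega> $ i" for i
    using real_cond_exp_cong[OF eq[of i] meas] real_cond_exp_F_meas[OF int[of i] snd] eq[of i]
    by eventually_elim simp
  then have "AE \<omega> in J. \<forall>i. real_cond_exp J ?F (\<lambda>\<omega>. fst \<omega> $ i) \<omega> = fst \<omega> $ i"
    by (simp add: AE_all_countable)
  then show ?thesis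
    by eventually_elim (simp add: posterior_mean_def J_def[symmetric] vec_eq_iff)
qed

lemma principal_value_full_revelation:
  fixes G Gt :: "real^'n^'n"
  assumes "\<sigma> > 0"
  shows "principal_value \<beta> G Gt \<mu> \<sigma> borel full_revelation
    = (\<integral>x. principal_payoff \<beta> Gt (equilibrium_matrix \<beta> G *v x) x \<partial>state_prior \<mu> \<sigma>)"
proof -
  let ?J = "joint_law \<mu> \<sigma> borel (full_revelation :: real^'n \<Rightarrow> _)" and ?B = "equilibrium_matrix \<beta> G"
  let ?y = "posterior_mean \<mu> \<sigma> borel full_revelation :: _ \<Rightarrow> real^'n"
  note signal = public_signal_full_revelation
  note [measurable] = measurable_fst_joint_law[OF signal assms]
  note x2 = square_integrable_joint_law_fst[OF signal assms]
  note y2 = square_integrable_posterior_mean[OF signal assms]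
  have "principal_value \<beta> G Gt \<mu> \<sigma> borel full_revelation
      = (\<integral>\<omega>. principal_payoff \<beta> Gt (?B *v fst \<omega>) (fst \<omega>) \<partial>?J)"
    unfolding principal_value_def
  \<comment> \<open>The posterior mean is known only up to null sets; the a.e. congruence rule asks
    for measurability of both integrands, which their integrability supplies.\<close>
  proof (rule integral_cong_AE)
    show "(\<lambda>\<omega>. principal_payoff \<beta> Gt (?B *v ?y \<omega>) (fst \<omega>)) \<in> borel_measurable ?J"
      by (rule borel_measurable_integrable[OF integrable_principal_payoff[OF y2 x2]])
    show "(\<lambda>\<omega>. principal_payoff \<beta> Gt (?B *v fst \<omega>) (fst \<omega>)) \<in> borel_measurable ?J"
      by (rule borel_measurable_integrable[OF integrable_principal_payoff[OF x2 x2]])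
    show "AE \<omega> in ?J. principal_payoff \<beta> Gt (?B *v ?y \<omega>) (fst \<omega>)
        = principal_payoff \<beta> Gt (?B *v fst \<omega>) (fst \<omega>)"
      using posterior_mean_full_revelation[OF assms, of \<mu>] by eventually_elim simp
  qed
  also have "\<dots> = (\<integral>x. principal_payoff \<beta> Gt (?B *v x) x \<partial>distr ?J borel fst)"
    by (rule integral_distr[symmetric]) auto
  finally show ?thesis
    unfolding distr_joint_law_fst[OF signal assms] .
qed

theorem proposition3:
  fixes G Gt :: "real^'n^'n" and \<beta> \<mu> \<sigma> :: real
  assumes "graph_matrix G" and "graph_matrix Gt"
    and "\<sigma> > 0" and "\<beta> \<ge> 0" and "\<beta> \<le> 1 / (2 * real CARD('n))"
  shows "optimal_signal TYPE('k) \<beta> G Gt \<mu> \<sigma> borel full_revelation"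
  \<comment> \<open>The same prior integral bounds every competitor and equals the value of full
    revelation.\<close>
  unfolding optimal_signal_def
  using public_signal_full_revelation principal_value_le[OF assms]
    principal_value_full_revelation[OF assms(3)]
  by metis

end
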